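(* Let $0<q<1$. For any integers $a\ge 0$, $b\ge 1$ and $n\ge b+1$, it holds that $$\sum_{\alpha \in I_{0}(b, n)}\zeta_{q}(\alpha_{1}, \ldots , \alpha_{b}, 1^{a})=\sum_{\beta \in I_{0}(a+1, a+b+1)}\zeta_{q}(\beta_{1}+n-b-1, \beta_{2}, \ldots , \beta_{a+1}).$$
   Context: For a multi-index $\alpha=(\alpha_1,\ldots,\alpha_r)$ of positive integers, $r$ is its depth and $\sum_{i=1}^r\alpha_i$ is its weight; $\alpha$ is called admissible if $\alpha_1\ge 2$. $I_0(r,n)$ is the (finite) set of admissible multi-indices of positive integers of depth $r$ and weight $n$. The symbol $1^a$ abbreviates the subsequence $(1,\ldots,1)$ of length $a$ (empty if $a=0$). For an admissible index $\alpha=(\alpha_1,\ldots,\alpha_r)$, the $q$-analogue of the multiple zeta value is $$\zeta_{q}(\alpha_{1}, \ldots , \alpha_{r}):=\sum_{m_{1}>\cdots >m_{r}>0}\frac{q^{(\alpha_{1}-1)m_{1}+\cdots +(\alpha_{r}-1)m_{r}}}{[m_{1}]^{\alpha_{1}} \cdots [m_{r}]^{\alpha_{r}}},$$ where the sum is over positive integers and $[n]:=(1-q^{n})/(1-q)$ is the $q$-integer. *)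

theory Defs
  imports "HOL-Analysis.Analysis"
begin

definition admissible :: "nat list \<Rightarrow> bool" where
  "admissible \<alpha> \<longleftrightarrow> \<alpha> \<noteq> [] \<and> (\<forall>x \<in> set \<alpha>. x \<ge> 1) \<and> hd \<alpha> \<ge> 2"

definition I0 :: "nat \<Rightarrow> nat \<Rightarrow> nat list set" where
  "I0 r n = {\<alpha>. admissible \<alpha> \<and> length \<alpha> = r \<and> sum_list \<alpha> = n}"

lemma finite_I0: "finite (I0 r n)"
proof (rule finite_subset)
  show "I0 r n \<subseteq> {\<alpha>. set \<alpha> \<subseteq> {..n} \<and> length \<alpha> = r}"
    by (auto simp: I0_def intro: member_le_sum_list)
qed (simp add: finite_lists_length_eq)

definition qint :: "real \<Rightarrow> nat \<Rightarrow> real" where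
  "qint q n = (1 - q ^ n) / (1 - q)"

definition decr_tuples :: "nat \<Rightarrow> nat list set" where
  "decr_tuples r = {m. length m = r \<and> sorted_wrt (>) m \<and> (\<forall>k \<in> set m. k > 0)}"

definition qmzv_term :: "real \<Rightarrow> nat list \<Rightarrow> nat list \<Rightarrow> real" where
  "qmzv_term q \<alpha> m =
     q ^ (\<Sum>i<length \<alpha>. (\<alpha> ! i - 1) * m ! i) / (\<Prod>i<length \<alpha>. qint q (m ! i) ^ (\<alpha> ! i))"

text \<open>The truncated subtraction in the exponent is harmless, as all entries of an index are
  positive. The infinite sum is unordered; for admissible indices and \<open>0 < q < 1\<close> it
  converges, as shown in \<open>qmzv_term_summable\<close> below, so its default value \<open>0\<close> for
  divergent sums plays no role.\<close>

definition qmzv :: "real \<Rightarrow> nat list \<Rightarrow> real" where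
  "qmzv q \<alpha> = (\<Sum>\<^sub>\<infinity>m\<in>decr_tuples (length \<alpha>). qmzv_term q \<alpha> m)"

lemma summable_power_sum_list:
  fixes x :: real
  assumes "0 \<le> x" "x < 1"
  shows "(\<lambda>m. x ^ sum_list m) summable_on {m :: nat list. length m = r}"
proof (induction r)
  case 0
  show ?case by simp
next
  case (Suc r)
  have geo: "(\<lambda>k. x ^ k) summable_on (UNIV :: nat set)"
    using assms by (intro norm_summable_imp_summable_on) (simp add: summable_geometric)
  have "(\<lambda>(k, m). x ^ k * x ^ sum_list m) summable_on UNIV \<times> {m :: nat list. length m = r}"
  proof (rule summable_on_SigmaI)
    fix k :: nat
    show "((\<lambda>m. case (k, m) of (k, m) \<Rightarrow> x ^ k * x ^ sum_list m) has_sum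
             x ^ k * (\<Sum>\<^sub>\<infinity>m\<in>{m. length m = r}. x ^ sum_list m)) {m. length m = r}"
      using has_sum_infsum[OF Suc] by (auto intro: has_sum_cmult_right)
  qed (use assms geo in \<open>auto intro: summable_on_cmult_left\<close>)
  moreover have "{m :: nat list. length m = Suc r} =
      (\<lambda>(k, m). k # m) ` (UNIV \<times> {m. length m = r})"
    by (auto simp: length_Suc_conv image_iff)
  moreover have "inj_on (\<lambda>(k, m). k # m) (UNIV \<times> {m :: nat list. length m = r})"
    by (auto intro: inj_onI)
  ultimately show ?case
    by (simp add: summable_on_reindex o_def case_prod_unfold power_add)
qed

lemma qint_ge_1:
  assumes "0 < q" "q < 1" "k > 0"
  shows "qint q k \<ge> 1"
proof -
  have "q ^ k \<le> q ^ 1"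
    using assms by (intro power_decreasing) auto
  thus ?thesis using assms by (simp add: qint_def field_simps)
qed

lemma qmzv_term_summable:
  assumes q: "0 < q" "q < 1" and \<alpha>: "admissible \<alpha>"
  shows "qmzv_term q \<alpha> summable_on decr_tuples (length \<alpha>)"
proof (rule summable_on_comparison_test)
  define r x where "r = length \<alpha>" and "x = root r q"
  have r: "r > 0" using \<alpha> by (auto simp: admissible_def r_def)
  have x: "0 \<le> x" "x < 1" "x ^ r = q"
    using q r by (auto simp: x_def real_root_pow_pos2)
  show "(\<lambda>m. x ^ sum_list m) summable_on decr_tuples (length \<alpha>)"
    by (rule summable_on_subset_banach[OF summable_power_sum_list[OF x(1,2), of r]])
       (auto simp: decr_tuples_def r_def)
  fix m assume "m \<in> decr_tuples (length \<alpha>)"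
  hence m: "length m = r" "sorted_wrt (>) m" "\<And>i. i < r \<Longrightarrow> m ! i > 0"
    by (auto simp: decr_tuples_def r_def)
  have ge1: "(\<Prod>i<r. qint q (m ! i) ^ (\<alpha> ! i)) \<ge> 1"
    using q m(3) by (intro prod_ge_1 one_le_power qint_ge_1) auto
  show "0 \<le> qmzv_term q \<alpha> m"
    using ge1 q by (simp add: qmzv_term_def r_def)
  have "m ! i \<le> m ! 0" if "i < r" for i
    using sorted_wrt_nth_less[OF m(2), of 0 i] m(1) that by (cases "i = 0") auto
  hence "(\<Sum>i<r. m ! i) \<le> (\<Sum>i<r. m ! 0)"
    by (intro sum_mono) auto
  hence sum_le: "sum_list m \<le> r * m ! 0"
    using m(1) by (simp add: sum_list_sum_nth atLeast0LessThan)
  have "m ! 0 \<le> (\<alpha> ! 0 - 1) * m ! 0"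
    using \<alpha> by (auto simp: admissible_def hd_conv_nth)
  also have "\<dots> \<le> (\<Sum>i<r. (\<alpha> ! i - 1) * m ! i)"
    using r by (intro member_le_sum) auto
  finally have "q ^ (\<Sum>i<r. (\<alpha> ! i - 1) * m ! i) \<le> q ^ (m ! 0)"
    using q by (intro power_decreasing) auto
  also have "\<dots> = x ^ (r * m ! 0)"
    by (simp add: power_mult x(3))
  also have "\<dots> \<le> x ^ sum_list m"
    using x sum_le by (intro power_decreasing) auto
  finally have le: "q ^ (\<Sum>i<r. (\<alpha> ! i - 1) * m ! i) \<le> x ^ sum_list m" .
  have "qmzv_term q \<alpha> m \<le> q ^ (\<Sum>i<r. (\<alpha> ! i - 1) * m ! i) / 1"
    unfolding qmzv_term_def r_def[symmetric] using ge1 q by (intro divide_left_mono) auto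
  with le show "qmzv_term q \<alpha> m \<le> x ^ sum_list m" by simp
qed

end

theory Submission
  imports Defs
begin

text \<open>
  Put \<open>c = n - b - 1\<close>. An index \<open>(\<alpha>\<^sub>1, \<dots>, \<alpha>\<^sub>r)\<close> is encoded as a word in two letters, each entry \<open>k\<close>
  becoming \<open>k - 1\<close> letters \<open>True\<close> followed by one \<open>False\<close>. The summands of \<open>\<zeta>\<^sub>q\<close> with a given
  largest variable \<open>m\<close> are then built up by reading the word from right to left: \<open>True\<close> multiplies
  by \<open>q\<^sup>m/[m]\<close>, and \<open>False\<close> sums over all smaller values and divides by \<open>[m]\<close>. In the second
  rule \<open>[m]\<close> is deformed to \<open>{m} = [m] - y q\<^sup>m\<close> with a parameter \<open>0 \<le> y < 1\<close>.

  The main tool is the connected sum method of Seki and Yamamoto. The nested sums of two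
  words, with largest variables \<open>m\<close> and \<open>n\<close>, are multiplied by a connector \<open>C(m, n)\<close> and summed over
  \<open>m\<close> and \<open>n\<close>. The connector satisfies a telescoping relation (\<open>conn_transport\<close>) by which the first
  letter of one word can be moved, with the other letter in its place, to the front of the other
  word. Moving all letters of a word turns it into its dual, that is, the reversed word with the
  two letters exchanged; hence a word that begins with \<open>True\<close> and ends with \<open>False\<close> has the same
  value as its dual, for every \<open>y\<close> (\<open>word_val_dual\<close>). For \<open>y = 0\<close> this is the duality of \<open>q\<close>-multiple
  zeta values, and the coefficients in \<open>y\<close> are a \<open>q\<close>-analogue of Ohno's relation.

  Duality is used twice. For \<open>y = 0\<close>: appending \<open>1\<^sup>a\<close> to \<open>\<alpha>\<close> adds \<open>a\<close> to the first entry of the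
  dual index, and dualization maps \<open>I\<^sub>0(b, n)\<close> onto \<open>I\<^sub>0(c + 1, n)\<close>. So the left-hand side is
  the sum of \<open>\<zeta>\<^sub>q(\<beta>\<^sub>1 + a, \<beta>\<^sub>2, \<dots>)\<close> over \<open>\<beta> \<in> I\<^sub>0(c + 1, c + b + 1)\<close> (\<open>sum_qmzv_append_ones\<close>), which is
  the right-hand side with \<open>a\<close> and \<open>c\<close> exchanged. For general \<open>y\<close>: expanding
  \<open>1/{m} = \<Sum>k. y\<^sup>k q\<^sup>k\<^sup>m/[m]\<^sup>k\<^sup>+\<^sup>1\<close> shows that the right-hand side is the coefficient
  of \<open>y\<^sup>b\<^sup>-\<^sup>1\<close> in the value of the word with \<open>c + 1\<close> letters \<open>True\<close> and then \<open>a + 1\<close> letters \<open>False\<close>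
  (\<open>word_val_hook_series\<close>). The dual of that word is the same word with \<open>a\<close> and \<open>c\<close> exchanged, so by
  duality and comparison of coefficients the right-hand side is symmetric in \<open>a\<close> and \<open>c\<close>
  (\<open>hook_sum_symmetric\<close>).

  All terms are nonnegative. Values of words are therefore taken in the extended nonnegative
  reals, where double series may be interchanged freely; finiteness is needed only to return to
  the real numbers and to compare coefficients.\<close>

section \<open>Double series and uniqueness of power series\<close>

lemma ennreal_suminf_swap:
  fixes f :: "nat \<Rightarrow> nat \<Rightarrow> ennreal"
  shows "(\<Sum>m. \<Sum>n. f m n) = (\<Sum>n. \<Sum>m. f m n)"
proof -
  have "(\<Sum>m. \<Sum>n. f m n) = (\<integral>\<^sup>+m. (\<Sum>n. f m n) \<partial>count_space UNIV)"
    by (simp add: nn_integral_count_space_nat)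
  also have "\<dots> = (\<Sum>n. \<integral>\<^sup>+m. f m n \<partial>count_space UNIV)"
    by (rule nn_integral_suminf) simp
  finally show ?thesis by (simp add: nn_integral_count_space_nat)
qed

text \<open>The expansion in the deformation parameter has nonnegative terms only where the parameter is
  nonnegative, so the coefficients have to be recovered from a one-sided neighbourhood of \<open>0\<close>. Once all coefficients
  before the \<open>n\<close>-th vanish, the series divided by \<open>x\<^sup>n\<close> tends to the \<open>n\<close>-th one.\<close>

lemma powser_zero_on_right:
  fixes a :: "nat \<Rightarrow> real"
  assumes sums: "\<And>x. 0 < x \<Longrightarrow> x < r \<Longrightarrow> (\<lambda>n. a n * x ^ n) sums 0" and r: "0 < r"
  shows "a n = 0"
proof (induction n rule: less_induct)
  case (less n)
  define g where "g x = (\<Sum>k. a (k + n) * x ^ k)" for x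
  have summ: "summable (\<lambda>k. a (k + n) * x ^ k)" if "\<bar>x\<bar> < r" for x
  proof (cases "x = 0")
    case False
    define x' where "x' = (\<bar>x\<bar> + r) / 2"
    have "summable (\<lambda>n. a n * x' ^ n)"
      using sums[of x'] r that by (auto simp: sums_iff x'_def)
    hence "summable (\<lambda>n. a n * x ^ n)"
      by (rule powser_inside) (use r that in \<open>auto simp: x'_def\<close>)
    hence "summable (\<lambda>k. a (k + n) * x ^ (k + n))"
      by (subst summable_iff_shift)
    hence "summable (\<lambda>k. a (k + n) * x ^ (k + n) / x ^ n)"
      by (rule summable_divide)
    thus ?thesis using False by (simp add: power_add)
  qed (auto simp: powser_sums_zero intro!: sums_summable[OF powser_sums_zero])
  have "(g \<longlongrightarrow> a (0 + n)) (at 0)"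
    by (rule powser_limit_0[OF r]) (use summ in \<open>auto simp: g_def summable_sums\<close>)
  hence "(g \<longlongrightarrow> a n) (at_right 0)"
    by (simp add: filterlim_at_split)
  moreover have "g x = 0" if "0 < x" "x < r" for x
  proof -
    have "(\<Sum>k<n. a k * x ^ k) = 0"
      using less by (intro sum.neutral) auto
    hence "(\<lambda>k. a (k + n) * x ^ (k + n)) sums 0"
      using sums[OF that] sums_iff_shift[of "\<lambda>n. a n * x ^ n" n 0] by simp
    hence "(\<lambda>k. a (k + n) * x ^ (k + n) / x ^ n) sums (0 / x ^ n)"
      by (rule sums_divide)
    thus ?thesis using that by (simp add: power_add g_def sums_iff)
  qed
  hence "eventually (\<lambda>x. g x = 0) (at_right 0)"
    unfolding eventually_at_right_field using r by blast
  hence "(g \<longlongrightarrow> 0) (at_right 0)"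
    by (rule tendsto_eventually)
  ultimately show "a n = 0"
    using tendsto_unique trivial_limit_at_right_real by blast
qed

lemma ennreal_powser_eqD:
  fixes a b :: "nat \<Rightarrow> real"
  assumes nonneg: "\<And>n. 0 \<le> a n" "\<And>n. 0 \<le> b n"
    and eq: "\<And>x. 0 < x \<Longrightarrow> x < 1 \<Longrightarrow> (\<Sum>n. ennreal (x ^ n * a n)) = (\<Sum>n. ennreal (x ^ n * b n))"
    and fin: "\<And>x. 0 < x \<Longrightarrow> x < 1 \<Longrightarrow> (\<Sum>n. ennreal (x ^ n * a n)) \<noteq> top"
  shows "a n = b n"
proof -
  have "(\<lambda>n. (a n - b n) * x ^ n) sums 0" if x: "0 < x" "x < 1" for x
  proof -
    have nn: "0 \<le> x ^ n * a n" "0 \<le> x ^ n * b n" for n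
      using nonneg x by auto
    have sa: "summable (\<lambda>n. x ^ n * a n)" and sb: "summable (\<lambda>n. x ^ n * b n)"
      using fin[OF x] eq[OF x] nn by (auto intro!: summable_suminf_not_top)
    have "ennreal (\<Sum>n. x ^ n * a n) = ennreal (\<Sum>n. x ^ n * b n)"
      using eq[OF x] suminf_ennreal2[OF nn(1) sa] suminf_ennreal2[OF nn(2) sb] by simp
    hence "(\<Sum>n. x ^ n * a n) = (\<Sum>n. x ^ n * b n)"
      using nn sa sb by (simp add: suminf_nonneg)
    thus ?thesis
      using sums_diff[OF summable_sums[OF sa] summable_sums[OF sb]] by (simp add: algebra_simps)
  qed
  thus ?thesis using powser_zero_on_right[of 1 "\<lambda>n. a n - b n" n] by simp
qed

section \<open>Nested sums attached to words\<close>

text \<open>The deformed \<open>q\<close>-integer \<open>{n}\<close>. The shift by a multiple of \<open>q\<^sup>n\<close> is chosen so that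
  \<open>{m + n} - q\<^sup>n {m} = [n]\<close> for every \<open>y\<close>, see \<open>dint_add\<close>.\<close>

definition dint :: "real \<Rightarrow> real \<Rightarrow> nat \<Rightarrow> real" where
  "dint q y n = qint q n - y * q ^ n"

text \<open>The empty word forces \<open>m = 0\<close>, so that the first \<open>False\<close> that is read, whose sum ranges over
  all \<open>k < m\<close> including \<open>0\<close>, contributes exactly \<open>1/{m}\<close> for \<open>m > 0\<close>. A nonempty word gives \<open>0\<close>
  at \<open>m = 0\<close>, because the sum is then empty and \<open>q\<^sup>0/[0] = 0\<close> by the convention for division by
  zero.\<close>

fun nested :: "real \<Rightarrow> real \<Rightarrow> bool list \<Rightarrow> nat \<Rightarrow> real" where
  "nested q y [] m = of_bool (m = 0)"
| "nested q y (True # w) m = q ^ m / qint q m * nested q y w m"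
| "nested q y (False # w) m = (\<Sum>k<m. nested q y w k) / dint q y m"

definition word_val :: "real \<Rightarrow> real \<Rightarrow> bool list \<Rightarrow> ennreal" where
  "word_val q y w = (\<Sum>m. ennreal (nested q y w m))"

context
  fixes q :: real
  assumes q: "0 < q" "q < 1"
begin

lemma power_le_qint: "n > 0 \<Longrightarrow> q ^ n \<le> qint q n"
  using qint_ge_1[OF q, of n] power_le_one[of q n] q by linarith

lemma qint_pos: "n > 0 \<Longrightarrow> 0 < qint q n"
  using qint_ge_1[OF q, of n] by linarith

lemma qint_nonneg: "0 \<le> qint q n"
  using qint_pos[of n] by (cases "n = 0") (auto simp: qint_def)

end

text \<open>This identity makes the difference of two neighbouring values of the connector a
  single product.\<close>

lemma dint_add: "dint q y (m + n) = q ^ n * dint q y m + qint q n"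
proof -
  have "qint q (m + n) = q ^ n * qint q m + qint q n"
    by (simp add: qint_def power_add algebra_simps flip: add_divide_distrib)
  thus ?thesis by (simp add: dint_def power_add algebra_simps)
qed

lemma nested_0: "w \<noteq> [] \<Longrightarrow> nested q y w 0 = 0"
  by (induction q y w "0::nat" rule: nested.induct) (auto simp: qint_def)

context
  fixes q y :: real
  assumes q: "0 < q" "q < 1" and y: "0 \<le> y" "y < 1"
begin

lemma dint_ge: "n > 0 \<Longrightarrow> (1 - y) * qint q n \<le> dint q y n"
  using power_le_qint[OF q, of n] y by (auto simp: dint_def algebra_simps intro: mult_left_mono)

lemma dint_pos: "n > 0 \<Longrightarrow> 0 < dint q y n"
  using dint_ge[of n] qint_pos[OF q, of n] y by (meson mult_pos_pos diff_gt_0_iff_gt less_le_trans)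

lemma dint_mono: "dint q y m \<le> dint q y (m + n)"
proof -
  have "q ^ (m + n) \<le> q ^ m" using q by (intro power_decreasing) auto
  moreover from this have "qint q m \<le> qint q (m + n)"
    using q by (simp add: qint_def divide_right_mono)
  ultimately show ?thesis using y by (auto simp: dint_def intro!: diff_mono mult_left_mono)
qed

lemma nested_nonneg: "0 \<le> nested q y w m"
proof (induction w arbitrary: m)
  case (Cons l w)
  show ?case
  proof (cases "m = 0")
    case True thus ?thesis by (simp add: nested_0)
  next
    case False
    thus ?thesis using Cons dint_pos[of m] qint_nonneg[OF q, of m] q
      by (cases l) (auto intro!: divide_nonneg_pos mult_nonneg_nonneg divide_nonneg_nonneg sum_nonneg)
  qed
qed simp

lemma prod_dint_pos: "0 < (\<Prod>h=1..n. dint q y h)"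
  by (intro prod_pos) (auto intro: dint_pos)

end

section \<open>The connected sum and duality of words\<close>

text \<open>A \<open>q\<close>-analogue of the inverse binomial coefficient \<open>m! n! / (m + n)!\<close>, with \<open>{h}\<close> in the place
  of \<open>h\<close>.\<close>

definition conn :: "real \<Rightarrow> real \<Rightarrow> nat \<Rightarrow> nat \<Rightarrow> real" where
  "conn q y m n = q ^ (m * n) * (\<Prod>h=1..m. dint q y h) * (\<Prod>h=1..n. dint q y h)
                    / (\<Prod>h=1..m+n. dint q y h)"

text \<open>With an empty word on one side, that variable is \<open>0\<close> and the connector is \<open>1\<close>, so the
  connected sum is the value of the other word: the process of moving letters starts and ends at
  values of words.\<close>

definition conn_sum :: "real \<Rightarrow> real \<Rightarrow> bool list \<Rightarrow> bool list \<Rightarrow> ennreal" where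
  "conn_sum q y w v = (\<Sum>m. \<Sum>n. ennreal (nested q y w m * nested q y v n * conn q y m n))"

lemma conn_commute: "conn q y m n = conn q y n m"
  by (simp add: conn_def mult.commute add.commute mult.left_commute)

lemma conn_sum_commute: "conn_sum q y w v = conn_sum q y v w"
  unfolding conn_sum_def
  by (subst ennreal_suminf_swap) (simp add: conn_commute mult.commute mult.left_commute)

definition dual :: "bool list \<Rightarrow> bool list" where
  "dual w = rev (map Not w)"

lemma dual_append: "dual (u @ v) = dual v @ dual u"
  by (simp add: dual_def)

lemma dual_replicate: "dual (replicate k l) = replicate k (\<not> l)"
  by (simp add: dual_def)

context
  fixes q y :: real
  assumes q: "0 < q" "q < 1" and y: "0 \<le> y" "y < 1"
begin

lemma conn_pos: "0 < conn q y m n"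
  unfolding conn_def using q prod_dint_pos[OF q y] by (intro divide_pos_pos mult_pos_pos) auto

lemma conn_0 [simp]: "conn q y 0 n = 1" "conn q y n 0 = 1"
proof -
  have "prod (dint q y) {Suc 0..n} \<noteq> 0"
    using prod_dint_pos[OF q y, of n] by (metis One_nat_def less_irrefl)
  thus "conn q y 0 n = 1" "conn q y n 0 = 1" by (simp_all add: conn_def del: prod_zero_iff)
qed

lemma conn_Suc: "conn q y (Suc m) n = q ^ n * (dint q y (Suc m) / dint q y (Suc m + n)) * conn q y m n"
  by (simp add: conn_def power_add ac_simps)

lemma conn_le: "conn q y m n \<le> (q ^ n) ^ m"
proof (induction m)
  case (Suc m)
  have "dint q y (Suc m) / dint q y (Suc m + n) \<le> 1"
    using dint_mono[OF q y, of "Suc m" n] dint_pos[OF q y, of "Suc m + n"] by simp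
  hence "q ^ n * (dint q y (Suc m) / dint q y (Suc m + n)) \<le> q ^ n * 1"
    using q by (intro mult_left_mono) auto
  thus ?case unfolding conn_Suc power_Suc
    using Suc q conn_pos[of m n] by (intro mult_mono) auto
qed simp

lemma conn_tendsto_0:
  assumes "n > 0" shows "(\<lambda>m. conn q y m n) \<longlonglongrightarrow> 0"
proof (rule tendsto_sandwich[of "\<lambda>_. 0"])
  show "(\<lambda>m. (q ^ n) ^ m) \<longlonglongrightarrow> 0"
    using q assms by (intro LIMSEQ_realpow_zero) (auto simp: power_less_one_iff)
qed (use conn_le conn_pos in \<open>auto simp: less_imp_le\<close>)

text \<open>By \<open>dint_add\<close>, \<open>C(m, n) - C(m + 1, n)\<close> is \<open>C(m, n)\<close> times \<open>[n]/{m + 1 + n}\<close>, and the factor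
  \<open>{m + 1}\<close> in \<open>C(m + 1, n)\<close> cancels against the denominator.\<close>

lemma conn_telescope:
  assumes "n > 0"
  shows "conn q y (Suc m) n / dint q y (Suc m) =
           q ^ n / qint q n * (conn q y m n - conn q y (Suc m) n)"
proof -
  define D S Q where "D = dint q y (Suc m)" and "S = dint q y (Suc m + n)" and "Q = qint q n"
  have S: "S = q ^ n * D + Q" unfolding S_def D_def Q_def by (rule dint_add)
  have pos: "D > 0" "S > 0" "Q > 0"
    using assms dint_pos[OF q y] qint_pos[OF q] by (auto simp: D_def S_def Q_def)
  have "conn q y m n - conn q y (Suc m) n = Q / S * conn q y m n"
    unfolding conn_Suc D_def[symmetric] S_def[symmetric] using pos by (simp add: field_simps S)
  moreover have "conn q y (Suc m) n / D = q ^ n / S * conn q y m n"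
    unfolding conn_Suc D_def[symmetric] S_def[symmetric] using pos by simp
  ultimately show ?thesis
    unfolding D_def[symmetric] Q_def[symmetric] using pos by simp
qed

text \<open>The relation behind everything: summing over a new largest variable \<open>m > p\<close> with weight
  \<open>1/{m}\<close>, which is the effect of a letter \<open>False\<close> on the left word, is the same as multiplying by
  \<open>q\<^sup>n/[n]\<close>, the effect of a letter \<open>True\<close> on the right word.\<close>

lemma conn_transport:
  assumes "n > 0"
  shows "(\<lambda>m. if p < m then conn q y m n / dint q y m else 0) sums (q ^ n / qint q n * conn q y p n)"
proof -
  let ?f = "\<lambda>m. if p < m then conn q y m n / dint q y m else 0"
  have "(\<lambda>k. conn q y (k + p) n - conn q y (Suc k + p) n) sums (conn q y (0 + p) n - 0)"
    by (rule telescope_sums')(rule LIMSEQ_ignore_initial_segment[OF conn_tendsto_0[OF assms]])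
  hence "(\<lambda>k. q ^ n / qint q n * (conn q y (k + p) n - conn q y (Suc k + p) n))
           sums (q ^ n / qint q n * conn q y p n)"
    by (intro sums_mult) simp
  hence "(\<lambda>k. ?f (k + Suc p)) sums (q ^ n / qint q n * conn q y p n)"
    using conn_telescope[OF assms] by simp
  moreover have "(\<Sum>m<Suc p. ?f m) = 0"
    by (rule sum.neutral) auto
  ultimately show ?thesis
    using sums_iff_shift[of ?f "Suc p" "q ^ n / qint q n * conn q y p n"] by simp
qed

text \<open>\<open>conn_transport\<close> is applied for each \<open>n\<close> separately. A nonempty \<open>v\<close> excludes \<open>n = 0\<close>, for which
  the sum of \<open>C(m, 0)/{m} = 1/{m}\<close> over \<open>m\<close> diverges.\<close>

lemma conn_sum_transport:
  assumes v: "v \<noteq> []"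
  shows "conn_sum q y (False # w) v = conn_sum q y w (True # v)"
proof -
  let ?B = "nested q y"
  define h where "h k m n = (if k < m then ?B w k * ?B v n * (conn q y m n / dint q y m) else 0)" for k m n
  have h0: "h k m n \<ge> 0" for k m n
    unfolding h_def using nested_nonneg[OF q y] conn_pos[of m n] dint_pos[OF q y, of m] by auto
  have 1: "ennreal (?B (False # w) m * ?B v n * conn q y m n) = (\<Sum>k. ennreal (h k m n))" for m n
  proof -
    have "(\<Sum>k. ennreal (h k m n)) = (\<Sum>k<m. ennreal (h k m n))"
      by (rule suminf_finite) (auto simp: h_def)
    also have "\<dots> = ennreal (\<Sum>k<m. h k m n)"
      using h0 by (simp add: sum_ennreal)
    also have "(\<Sum>k<m. h k m n) = ?B (False # w) m * ?B v n * conn q y m n"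
      by (simp add: h_def sum_distrib_left sum_divide_distrib mult_ac)
    finally show ?thesis by simp
  qed
  have 2: "(\<Sum>m. ennreal (h k m n)) = ennreal (?B w k * ?B (True # v) n * conn q y k n)" for k n
  proof (cases "n = 0")
    case True
    hence "h k m n = 0" for m
      using v by (simp add: h_def nested_0)
    thus ?thesis using True v by (simp add: nested_0)
  next
    case False
    have "(\<lambda>m. h k m n) sums (?B w k * ?B v n * (q ^ n / qint q n * conn q y k n))"
      using sums_mult[OF conn_transport[of n k], of "?B w k * ?B v n"] False
      by (simp add: h_def if_distrib cong: if_cong)
    hence "(\<Sum>m. ennreal (h k m n)) = ennreal (?B w k * ?B v n * (q ^ n / qint q n * conn q y k n))"
      by (intro suminf_ennreal_eq h0)
    thus ?thesis by (simp add: mult_ac)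
  qed
  have "conn_sum q y (False # w) v = (\<Sum>n. \<Sum>m. \<Sum>k. ennreal (h k m n))"
    unfolding conn_sum_def 1 by (rule ennreal_suminf_swap)
  also have "\<dots> = (\<Sum>n. \<Sum>k. \<Sum>m. ennreal (h k m n))"
    by (subst ennreal_suminf_swap) simp
  also have "\<dots> = (\<Sum>k. \<Sum>n. \<Sum>m. ennreal (h k m n))"
    by (rule ennreal_suminf_swap)
  finally show ?thesis by (simp add: 2 conn_sum_def)
qed

lemma conn_sum_Nil: "conn_sum q y [] v = word_val q y v"
proof -
  have "(\<Sum>n. ennreal (nested q y [] m * nested q y v n * conn q y m n)) =
        (if m = 0 then word_val q y v else 0)" for m
    by (cases "m = 0") (simp_all add: word_val_def)
  thus ?thesis unfolding conn_sum_def
    by (subst suminf_finite[of "{0}"]) (auto simp: word_val_def)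
qed

text \<open>Letters are moved one at a time. A letter \<open>False\<close> needs \<open>v\<close> to be nonempty, which is preserved;
  a letter \<open>True\<close> needs the rest of \<open>w\<close> to be nonempty, which holds because \<open>w\<close> ends with \<open>False\<close>.\<close>

lemma conn_sum_dual:
  assumes "v \<noteq> []" "w = [] \<or> \<not> last w"
  shows "conn_sum q y w v = word_val q y (dual w @ v)"
  using assms
proof (induction w arbitrary: v)
  case Nil
  thus ?case by (simp add: conn_sum_Nil dual_def)
next
  case (Cons l w)
  show ?case
  proof (cases l)
    case True
    hence "w \<noteq> []" using Cons.prems by auto
    hence "conn_sum q y (l # w) v = conn_sum q y w (False # v)"
      using True conn_sum_transport[of w v] by (metis conn_sum_commute)
    thus ?thesis using Cons True by (auto simp: dual_def split: if_splits)
  next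
    case False
    hence "conn_sum q y (l # w) v = conn_sum q y w (True # v)"
      using conn_sum_transport[of v w] Cons by simp
    thus ?thesis using Cons False by (auto simp: dual_def split: if_splits)
  qed
qed

text \<open>The value of \<open>w\<close> is its connected sum with the empty word. Only a letter \<open>True\<close> can be moved to
  the empty word; from then on \<open>conn_sum_dual\<close> applies.\<close>

theorem word_val_dual:
  assumes "w \<noteq> []" "hd w" "\<not> last w"
  shows "word_val q y (dual w) = word_val q y w"
proof -
  obtain w' where w: "w = True # w'" using assms by (cases w) auto
  hence "w' \<noteq> []" using assms by auto
  have "word_val q y w = conn_sum q y (True # w') []"
    unfolding w by (metis conn_sum_commute conn_sum_Nil)
  also have "\<dots> = conn_sum q y w' [False]"
    using conn_sum_transport[of w' "[]"] \<open>w' \<noteq> []\<close> by (metis conn_sum_commute)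
  also have "\<dots> = word_val q y (dual w)"
    using assms \<open>w' \<noteq> []\<close> by (subst conn_sum_dual) (auto simp: w dual_def)
  finally show ?thesis by simp
qed

end

section \<open>Indices as words\<close>

definition index_word :: "nat list \<Rightarrow> bool list" where
  "index_word \<alpha> = concat (map (\<lambda>k. replicate (k - 1) True @ [False]) \<alpha>)"

lemma index_word_simps [simp]:
  "index_word [] = []"
  "index_word (k # \<alpha>) = replicate (k - 1) True @ False # index_word \<alpha>"
  "index_word (\<alpha> @ \<beta>) = index_word \<alpha> @ index_word \<beta>"
  "index_word (replicate a 1) = replicate a False"
  by (induction a) (simp_all add: index_word_def)

lemma nested_replicate_True:
  "nested q y (replicate k True @ w) m = (q ^ m / qint q m) ^ k * nested q y w m"
  by (induction k) auto

text \<open>The default value \<open>0\<close> for the empty tuple matches the value of \<open>nested\<close> on the empty word, and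
  makes the condition \<open>lead t < k\<close> correct for prepending \<open>k\<close> also when \<open>t\<close> is empty.\<close>

definition lead :: "nat list \<Rightarrow> nat" where
  "lead m = (case m of [] \<Rightarrow> 0 | k # _ \<Rightarrow> k)"

definition tuples_lead :: "nat \<Rightarrow> nat \<Rightarrow> nat list set" where
  "tuples_lead r k = {m \<in> decr_tuples r. lead m = k}"

lemma tuples_lead_0: "tuples_lead 0 k = (if k = 0 then {[]} else {})"
  by (auto simp: tuples_lead_def decr_tuples_def lead_def)

lemma tuples_lead_Suc: "tuples_lead (Suc r) k = (\<Union>j<k. (#) k ` tuples_lead r j)"
proof (rule set_eqI)
  fix m
  show "m \<in> tuples_lead (Suc r) k \<longleftrightarrow> m \<in> (\<Union>j<k. (#) k ` tuples_lead r j)"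
  proof (cases m)
    case Nil
    thus ?thesis by (auto simp: tuples_lead_def decr_tuples_def)
  next
    case (Cons x t)
    have "0 < x \<and> (\<forall>z\<in>set t. z < x) \<longleftrightarrow> lead t < x" if "t \<in> decr_tuples r"
      using that by (cases t) (auto simp: decr_tuples_def lead_def)
    thus ?thesis
      by (auto simp: Cons tuples_lead_def decr_tuples_def lead_def)
  qed
qed

lemma finite_tuples_lead: "finite (tuples_lead r k)"
  by (induction r arbitrary: k) (auto simp: tuples_lead_0 tuples_lead_Suc)

lemma qmzv_term_Cons:
  "qmzv_term q (k # \<alpha>) (m # t) = q ^ ((k - 1) * m) / qint q m ^ k * qmzv_term q \<alpha> t"
  by (simp add: qmzv_term_def lessThan_Suc_eq_insert_0 sum.reindex prod.reindex power_add)

text \<open>The undeformed nested sum collects the terms of the \<open>q\<close>-multiple zeta value by the largest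
  summation variable; there are only finitely many for each.\<close>

lemma nested_index_word:
  assumes "\<forall>k\<in>set \<alpha>. k \<ge> 1"
  shows "nested q 0 (index_word \<alpha>) m = (\<Sum>t\<in>tuples_lead (length \<alpha>) m. qmzv_term q \<alpha> t)"
  using assms
proof (induction \<alpha> arbitrary: m)
  case Nil
  thus ?case by (simp add: tuples_lead_0 qmzv_term_def)
next
  case (Cons k \<alpha>)
  let ?c = "q ^ ((k - 1) * m) / qint q m ^ k"
  have "(\<Sum>t\<in>tuples_lead (length (k # \<alpha>)) m. qmzv_term q (k # \<alpha>) t) =
        (\<Sum>j<m. \<Sum>t\<in>(#) m ` tuples_lead (length \<alpha>) j. qmzv_term q (k # \<alpha>) t)"
    unfolding length_Cons tuples_lead_Suc
    by (subst sum.UNION_disjoint) (auto simp: finite_tuples_lead, auto simp: tuples_lead_def)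
  also have "\<dots> = ?c * (\<Sum>j<m. nested q 0 (index_word \<alpha>) j)"
    using Cons by (simp add: sum.reindex qmzv_term_Cons sum_distrib_left)
  also have "?c = (q ^ m / qint q m) ^ (k - 1) / qint q m"
    using Cons.prems power_mult[of q m "k - 1"] by (cases k) (simp_all add: power_divide mult.commute)
  finally show ?case
    by (simp add: nested_replicate_True dint_def)
qed

lemma decr_tuples_decomp: "bij_betw snd (SIGMA m:UNIV. tuples_lead r m) (decr_tuples r)"
  by (rule bij_betw_byWitness[where f' = "\<lambda>t. (lead t, t)"]) (auto simp: tuples_lead_def)

lemma word_val_index_word:
  assumes q: "0 < q" "q < 1" and \<alpha>: "admissible \<alpha>"
  shows "word_val q 0 (index_word \<alpha>) = ennreal (qmzv q \<alpha>)"
proof -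
  have "(qmzv_term q \<alpha> has_sum qmzv q \<alpha>) (decr_tuples (length \<alpha>))"
    unfolding qmzv_def using qmzv_term_summable[OF assms] by (rule has_sum_infsum)
  hence "((\<lambda>p. qmzv_term q \<alpha> (snd p)) has_sum qmzv q \<alpha>) (SIGMA m:UNIV. tuples_lead (length \<alpha>) m)"
    by (subst has_sum_reindex_bij_betw[OF decr_tuples_decomp])
  hence "((\<lambda>m. nested q 0 (index_word \<alpha>) m) has_sum qmzv q \<alpha>) UNIV"
    by (rule has_sum_SigmaD)
       (use \<alpha> in \<open>auto simp: nested_index_word admissible_def finite_tuples_lead\<close>)
  hence "nested q 0 (index_word \<alpha>) sums qmzv q \<alpha>"
    by (rule has_sum_imp_sums)
  thus ?thesis
    unfolding word_val_def by (intro suminf_ennreal_eq) (use nested_nonneg[OF q, of 0] in auto)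
qed

lemma last_index_word: "\<alpha> \<noteq> [] \<Longrightarrow> \<not> last (index_word \<alpha>)"
  by (induction \<alpha> rule: rev_induct) auto

lemma hd_index_word: "admissible \<alpha> \<Longrightarrow> index_word \<alpha> \<noteq> [] \<and> hd (index_word \<alpha>)"
  by (cases \<alpha>) (auto simp: admissible_def hd_append)

text \<open>The images of the admissible indices: the first letter is \<open>True\<close> because the first entry is at
  least \<open>2\<close>. The depth of the index is the number \<open>r\<close> of letters \<open>False\<close>, its weight the length
  \<open>r + s\<close> of the word.\<close>

definition admissible_words :: "nat \<Rightarrow> nat \<Rightarrow> bool list set" where
  "admissible_words r s = {w. w \<noteq> [] \<and> hd w \<and> \<not> last w \<and> count_list w False = r \<and> count_list w True = s}"

text \<open>The left inverse of \<open>index_word\<close>. Words without a letter \<open>False\<close> encode no index and are sent to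
  \<open>[]\<close>.\<close>

fun word_index :: "bool list \<Rightarrow> nat list" where
  "word_index [] = []"
| "word_index (False # w) = 1 # word_index w"
| "word_index (True # w) = (case word_index w of [] \<Rightarrow> [] | k # \<alpha> \<Rightarrow> Suc k # \<alpha>)"

lemma word_index_index_word:
  assumes "\<forall>k\<in>set \<alpha>. k \<ge> 1"
  shows "word_index (index_word \<alpha>) = \<alpha>"
  using assms
proof (induction \<alpha>)
  case (Cons k \<alpha>)
  have "word_index (replicate j True @ False # index_word \<alpha>) = Suc j # \<alpha>" for j
    using Cons by (induction j) auto
  thus ?case using Cons by simp
qed simp

lemma index_word_word_index:
  assumes "w = [] \<or> \<not> last w"
  shows "index_word (word_index w) = w \<and> (\<forall>k\<in>set (word_index w). k \<ge> 1)"
  using assms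
proof (induction w rule: word_index.induct)
  case (3 w)
  hence "w \<noteq> []" "\<not> last w" by (auto split: if_splits)
  with 3 show ?case
  proof (cases "word_index w")
    case (Cons j \<alpha>)
    with 3 \<open>w \<noteq> []\<close> \<open>\<not> last w\<close> obtain i where "j = Suc i" by (cases j) auto
    with 3 \<open>w \<noteq> []\<close> \<open>\<not> last w\<close> Cons show ?thesis by auto
  qed (use 3 \<open>w \<noteq> []\<close> \<open>\<not> last w\<close> in auto)
qed (auto split: if_splits)

lemma count_index_word:
  assumes "\<forall>k\<in>set \<alpha>. k \<ge> 1"
  shows "count_list (index_word \<alpha>) False = length \<alpha> \<and>
         count_list (index_word \<alpha>) True + length \<alpha> = sum_list \<alpha>"
proof -
  have [simp]: "count_list (replicate j x) z = (if x = z then j else 0)" for j x and z :: bool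
    by (induction j) auto
  show ?thesis using assms by (induction \<alpha>) auto
qed

lemma bij_betw_index_word: "bij_betw index_word (I0 r (r + s)) (admissible_words r s)"
proof (rule bij_betw_byWitness[where f' = word_index])
  show "\<forall>\<alpha>\<in>I0 r (r + s). word_index (index_word \<alpha>) = \<alpha>"
    by (auto simp: I0_def admissible_def word_index_index_word)
  show "\<forall>w\<in>admissible_words r s. index_word (word_index w) = w"
    by (auto simp: admissible_words_def index_word_word_index)
  show "index_word ` I0 r (r + s) \<subseteq> admissible_words r s"
  proof safe
    fix \<alpha> assume "\<alpha> \<in> I0 r (r + s)"
    thus "index_word \<alpha> \<in> admissible_words r s"
      using count_index_word[of \<alpha>] hd_index_word[of \<alpha>] last_index_word[of \<alpha>]
      by (auto simp: I0_def admissible_words_def admissible_def)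
  qed
  show "word_index ` admissible_words r s \<subseteq> I0 r (r + s)"
  proof safe
    fix w assume w: "w \<in> admissible_words r s"
    define \<alpha> where "\<alpha> = word_index w"
    have *: "index_word \<alpha> = w" "\<forall>k\<in>set \<alpha>. k \<ge> 1"
      using index_word_word_index[of w] w by (auto simp: \<alpha>_def admissible_words_def)
    from w have "\<alpha> \<noteq> []" "hd (index_word \<alpha>)" using * by (auto simp: admissible_words_def)
    hence "hd \<alpha> \<ge> 2" using *(2) by (cases \<alpha>; cases "hd \<alpha> - 1") auto
    thus "word_index w \<in> I0 r (r + s)"
      using * w count_index_word[of \<alpha>] \<open>\<alpha> \<noteq> []\<close>
      by (auto simp: I0_def admissible_def admissible_words_def simp flip: \<alpha>_def)
  qed
qed

text \<open>Dualization exchanges the number of letters \<open>False\<close> (the depth) with the number of letters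
  \<open>True\<close> (the weight minus the depth).\<close>

lemma bij_betw_dual: "bij_betw dual (admissible_words r s) (admissible_words s r)"
proof -
  have [simp]: "count_list (map Not w) x = count_list w (\<not> x)" for w x
    by (induction w) auto
  have [simp]: "count_list (rev w) x = count_list w x" for w :: "bool list" and x
    by (induction w) auto
  show ?thesis
    by (rule bij_betw_byWitness[where f' = dual])
       (auto simp: dual_def admissible_words_def rev_map hd_rev last_rev hd_map last_map o_def)
qed

section \<open>Expansion in the deformation parameter\<close>

text \<open>The amounts by which the entries of an index exceed those of \<open>(1, \<dots>, 1)\<close> or, for admissible
  indices, of \<open>(2, 1, \<dots>, 1)\<close>.\<close>

definition weak_compositions :: "nat \<Rightarrow> nat \<Rightarrow> nat list set" where
  "weak_compositions r j = {e. length e = r \<and> sum_list e = j}"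

lemma weak_compositions_0: "weak_compositions 0 j = (if j = 0 then {[]} else {})"
  by (auto simp: weak_compositions_def)

lemma weak_compositions_Suc: "weak_compositions (Suc r) j = (\<Union>k\<le>j. (#) k ` weak_compositions r (j - k))"
  by (fastforce simp: weak_compositions_def length_Suc_conv image_iff)

lemma finite_weak_compositions: "finite (weak_compositions r j)"
  by (induction r arbitrary: j) (auto simp: weak_compositions_0 weak_compositions_Suc)

lemma bij_betw_weak_compositions_I0:
  "bij_betw (\<lambda>e. (hd e + 2) # map Suc (tl e)) (weak_compositions (r + 1) j) (I0 (r + 1) (r + 1 + (j + 1)))"
proof (rule bij_betw_byWitness[where f' = "\<lambda>\<alpha>. (hd \<alpha> - 2) # map (\<lambda>k. k - 1) (tl \<alpha>)"])
  have *: "sum_list (map Suc e) = sum_list e + length e" for e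
    by (induction e) auto
  have **: "sum_list (map (\<lambda>k. k - Suc 0) \<alpha>) + length \<alpha> = sum_list \<alpha>" if "\<forall>k\<in>set \<alpha>. k \<ge> Suc 0" for \<alpha>
    using that by (induction \<alpha>) auto
  have ***: "map (\<lambda>x. Suc (x - Suc 0)) \<alpha> = \<alpha>" if "\<forall>k\<in>set \<alpha>. k \<ge> Suc 0" for \<alpha>
    using that by (induction \<alpha>) auto
  show "\<forall>e\<in>weak_compositions (r + 1) j. ((hd ((hd e + 2) # map Suc (tl e)) - 2) #
          map (\<lambda>k. k - 1) (tl ((hd e + 2) # map Suc (tl e)))) = e"
    by (auto simp: weak_compositions_def length_Suc_conv o_def)
  show "\<forall>\<alpha>\<in>I0 (r + 1) (r + 1 + (j + 1)). (hd ((hd \<alpha> - 2) # map (\<lambda>k. k - 1) (tl \<alpha>)) + 2) #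
          map Suc (tl ((hd \<alpha> - 2) # map (\<lambda>k. k - 1) (tl \<alpha>))) = \<alpha>"
    by (auto simp: I0_def admissible_def length_Suc_conv o_def ***)
  show "(\<lambda>e. (hd e + 2) # map Suc (tl e)) ` weak_compositions (r + 1) j \<subseteq> I0 (r + 1) (r + 1 + (j + 1))"
    by (auto simp: weak_compositions_def I0_def admissible_def length_Suc_conv *)
  show "(\<lambda>\<alpha>. (hd \<alpha> - 2) # map (\<lambda>k. k - 1) (tl \<alpha>)) ` I0 (r + 1) (r + 1 + (j + 1)) \<subseteq> weak_compositions (r + 1) j"
    using ** by (fastforce simp: weak_compositions_def I0_def admissible_def length_Suc_conv)
qed

lemma qmzv_nonneg:
  assumes "0 < q" "q < 1" shows "0 \<le> qmzv q \<alpha>"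
  unfolding qmzv_def qmzv_term_def
  using assms qint_nonneg[OF assms]
  by (auto intro!: infsum_nonneg divide_nonneg_nonneg prod_nonneg)

context
  fixes q y :: real
  assumes q: "0 < q" "q < 1" and y: "0 \<le> y" "y < 1"
begin

text \<open>Each of the \<open>r\<close> factors \<open>1/{m}\<close> is a geometric series in \<open>y q\<^sup>m/[m]\<close>, and its \<open>k\<close>-th term raises
  the corresponding entry of the index from \<open>1\<close> to \<open>k + 1\<close>. The induction step multiplies one such
  series into the product by the Cauchy product formula.\<close>

lemma nested_y_series:
  "(\<lambda>j. y ^ j * (\<Sum>e\<in>weak_compositions r j. nested q 0 (index_word (map Suc e)) m))
     sums nested q y (replicate r False) m"
proof (induction r arbitrary: m)
  case 0
  have "(\<lambda>j. if j = 0 then of_bool (m = 0) else 0 :: real) sums of_bool (m = 0)"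
    by (rule sums_single)
  moreover have "y ^ j * (\<Sum>e\<in>weak_compositions 0 j. nested q 0 (index_word (map Suc e)) m) =
      (if j = 0 then of_bool (m = 0) else 0)" for j
    by (simp add: weak_compositions_0)
  ultimately show ?case by simp
next
  case (Suc r)
  let ?B = "\<lambda>e. nested q 0 (index_word (map Suc e))"
  show ?case
  proof (cases "m = 0")
    case True
    have "?B e 0 = 0" if "e \<in> weak_compositions (Suc r) j" for e j
      using that by (intro nested_0) (auto simp: weak_compositions_def length_Suc_conv)
    thus ?thesis using True by simp
  next
    case False
    define t where "t = q ^ m / qint q m"
    define g where "g l = (\<Sum>n<m. \<Sum>e\<in>weak_compositions r l. ?B e n) / qint q m" for l
    have pos: "0 < qint q m" using qint_pos[OF q] False by simp
    have t: "0 \<le> t" "t \<le> 1"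
      using power_le_qint[OF q, of m] False pos q by (auto simp: t_def)
    have yt: "0 \<le> y * t" "y * t < 1"
      using y t by (auto intro: le_less_trans[OF mult_left_le])
    have "(\<lambda>j. (\<Sum>n<m. y ^ j * (\<Sum>e\<in>weak_compositions r j. ?B e n)) / qint q m) sums
            ((\<Sum>n<m. nested q y (replicate r False) n) / qint q m)"
      by (intro sums_divide sums_sum Suc)
    hence G: "(\<lambda>j. y ^ j * g j) sums ((\<Sum>n<m. nested q y (replicate r False) n) / qint q m)"
      by (simp add: g_def sum_distrib_left)
    have "0 \<le> y ^ j * g j" for j
      unfolding g_def using y pos nested_nonneg[OF q, of 0]
      by (auto intro!: mult_nonneg_nonneg divide_nonneg_pos sum_nonneg)
    hence "summable (\<lambda>j. norm (y ^ j * g j))"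
      using G by (simp add: sums_iff)
    moreover have "summable (\<lambda>k. norm ((y * t) ^ k))"
      using yt by (simp add: summable_geometric)
    ultimately have "(\<lambda>j. \<Sum>k\<le>j. (y * t) ^ k * (y ^ (j - k) * g (j - k))) sums
        ((\<Sum>k. (y * t) ^ k) * (\<Sum>j. y ^ j * g j))"
      by (intro Cauchy_product_sums)
    also have "(\<Sum>j. y ^ j * g j) = (\<Sum>n<m. nested q y (replicate r False) n) / qint q m"
      using G by (simp add: sums_iff)
    also have "(\<Sum>k. (y * t) ^ k) = 1 / (1 - y * t)"
      using yt by (intro suminf_geometric) simp
    also have "1 / (1 - y * t) * ((\<Sum>n<m. nested q y (replicate r False) n) / qint q m) =
        nested q y (replicate (Suc r) False) m"
    proof -
      have "dint q y m = qint q m * (1 - y * t)"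
        using pos by (simp add: dint_def t_def field_simps)
      thus ?thesis by (simp add: mult.commute)
    qed
    also have "(\<lambda>j. \<Sum>k\<le>j. (y * t) ^ k * (y ^ (j - k) * g (j - k))) =
        (\<lambda>j. y ^ j * (\<Sum>e\<in>weak_compositions (Suc r) j. ?B e m))"
    proof
      fix j
      have "(\<Sum>e\<in>weak_compositions (Suc r) j. ?B e m) =
            (\<Sum>k\<le>j. \<Sum>e\<in>weak_compositions r (j - k). ?B (k # e) m)"
        unfolding weak_compositions_Suc
        by (subst sum.UNION_disjoint) (auto simp: finite_weak_compositions sum.reindex)
      also have "\<dots> = (\<Sum>k\<le>j. t ^ k * g (j - k))"
      proof (intro sum.cong refl)
        fix k
        have "(\<Sum>e\<in>weak_compositions r (j - k). ?B (k # e) m) =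
              (\<Sum>e\<in>weak_compositions r (j - k). t ^ k * (\<Sum>n<m. ?B e n) / qint q m)"
          by (simp add: nested_replicate_True t_def dint_def)
        also have "\<dots> = t ^ k * g (j - k)"
          unfolding g_def
          by (subst sum.swap) (simp add: sum_distrib_left sum_divide_distrib)
        finally show "(\<Sum>e\<in>weak_compositions r (j - k). ?B (k # e) m) = t ^ k * g (j - k)" .
      qed
      finally have "y ^ j * (\<Sum>e\<in>weak_compositions (Suc r) j. ?B e m) =
          (\<Sum>k\<le>j. y ^ j * (t ^ k * g (j - k)))"
        by (simp add: sum_distrib_left)
      also have "\<dots> = (\<Sum>k\<le>j. (y * t) ^ k * (y ^ (j - k) * g (j - k)))"
      proof (intro sum.cong refl)
        fix k assume "k \<in> {..j}"
        hence "y ^ j = y ^ k * y ^ (j - k)" by (simp flip: power_add)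
        thus "y ^ j * (t ^ k * g (j - k)) = (y * t) ^ k * (y ^ (j - k) * g (j - k))"
          by (simp add: power_mult_distrib)
      qed
      finally show "(\<Sum>k\<le>j. (y * t) ^ k * (y ^ (j - k) * g (j - k))) =
          y ^ j * (\<Sum>e\<in>weak_compositions (Suc r) j. ?B e m)" by simp
    qed
    finally show ?thesis .
  qed
qed

text \<open>Each deformed denominator is at least \<open>1 - y\<close> times the original one, so the deformation
  preserves finiteness.\<close>

lemma nested_le: "nested q y w m \<le> (1 / (1 - y)) ^ length w * nested q 0 w m"
proof (induction w arbitrary: m)
  case (Cons l w)
  let ?K = "1 / (1 - y)"
  have K: "?K \<ge> 1" using y by simp
  show ?case
  proof (cases "m = 0")
    case True
    thus ?thesis by (simp add: nested_0)
  next
    case False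
    hence pos: "0 < qint q m" "0 < dint q y m" using qint_pos[OF q] dint_pos[OF q y] by auto
    show ?thesis
    proof (cases l)
      case True
      have "q ^ m / qint q m * nested q y w m \<le> q ^ m / qint q m * (?K ^ length w * nested q 0 w m)"
        using Cons pos q by (intro mult_left_mono) auto
      also have "\<dots> \<le> ?K * (q ^ m / qint q m * (?K ^ length w * nested q 0 w m))"
        using K pos q y nested_nonneg[OF q, of 0 w m]
        by (intro mult_right_mono[of 1 ?K, simplified mult_1_left]) auto
      finally show ?thesis using True by (simp add: mult_ac)
    next
      case False
      have "(\<Sum>k<m. nested q y w k) / dint q y m \<le> (\<Sum>k<m. ?K ^ length w * nested q 0 w k) / ((1 - y) * qint q m)"
        using Cons pos y dint_ge[OF q y, of m] \<open>m \<noteq> 0\<close> nested_nonneg[OF q, of 0 w] nested_nonneg[OF q y, of w]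
        by (intro frac_le sum_mono sum_nonneg) auto
      also have "\<dots> = ?K ^ length (l # w) * nested q 0 (l # w) m"
        using False by (simp add: dint_def flip: sum_distrib_left)
      finally show ?thesis using False by simp
    qed
  qed
qed simp

lemma word_val_finite:
  assumes "word_val q 0 w \<noteq> top"
  shows "word_val q y w \<noteq> top"
proof -
  let ?K = "(1 / (1 - y)) ^ length w"
  have "word_val q y w \<le> (\<Sum>m. ennreal (?K * nested q 0 w m))"
    unfolding word_val_def by (intro suminf_le ennreal_leI nested_le) auto
  also have "\<dots> = ennreal ?K * word_val q 0 w"
    using y nested_nonneg[OF q, of 0] by (simp add: word_val_def ennreal_mult')
  finally show ?thesis
    using assms by (auto simp: top_unique ennreal_mult_eq_top_iff)
qed

text \<open>The \<open>c + 1\<close> leading letters \<open>True\<close> contribute the factor \<open>(q\<^sup>m/[m])\<^sup>c\<^sup>+\<^sup>1\<close>, which raises the first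
  entry by \<open>c + 1\<close>; one of these makes the index admissible, and the other \<open>c\<close> are the shift of
  \<open>hd \<beta>\<close>.\<close>

lemma word_val_hook_series:
  "word_val q y (replicate (c + 1) True @ replicate (a + 1) False) =
     (\<Sum>j. ennreal (y ^ j * (\<Sum>\<beta>\<in>I0 (a + 1) (a + 1 + (j + 1)). qmzv q ((hd \<beta> + c) # tl \<beta>))))"
proof -
  let ?h = "\<lambda>e. (hd e + 2 + c) # map Suc (tl e)"
  let ?P = "weak_compositions (a + 1)"
  have hook: "nested q 0 (index_word (?h e)) m = (q ^ m / qint q m) ^ (c + 1) * nested q 0 (index_word (map Suc e)) m"
    if "e \<in> ?P j" for e j m
  proof -
    from that obtain k e' where e: "e = k # e'" by (auto simp: weak_compositions_def length_Suc_conv)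
    show ?thesis by (simp add: e nested_replicate_True power_add mult_ac)
  qed
  have sum_hook: "(\<Sum>e\<in>?P j. nested q 0 (index_word (?h e)) m) =
      (q ^ m / qint q m) ^ (c + 1) * (\<Sum>e\<in>?P j. nested q 0 (index_word (map Suc e)) m)" for j m
    unfolding sum_distrib_left by (intro sum.cong refl hook)
  have 1: "ennreal (nested q y (replicate (c + 1) True @ replicate (a + 1) False) m) =
        (\<Sum>j. ennreal (y ^ j * (\<Sum>e\<in>?P j. nested q 0 (index_word (?h e)) m)))" for m
  proof (rule suminf_ennreal_eq[symmetric])
    have "(\<lambda>j. (q ^ m / qint q m) ^ (c + 1) * (y ^ j * (\<Sum>e\<in>?P j. nested q 0 (index_word (map Suc e)) m)))
       sums nested q y (replicate (c + 1) True @ replicate (a + 1) False) m"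
      unfolding nested_replicate_True by (intro sums_mult nested_y_series)
    also have "(\<lambda>j. (q ^ m / qint q m) ^ (c + 1) * (y ^ j * (\<Sum>e\<in>?P j. nested q 0 (index_word (map Suc e)) m))) =
        (\<lambda>j. y ^ j * (\<Sum>e\<in>?P j. nested q 0 (index_word (?h e)) m))"
      by (simp only: sum_hook mult.left_commute)
    finally show "(\<lambda>j. y ^ j * (\<Sum>e\<in>?P j. nested q 0 (index_word (?h e)) m))
        sums nested q y (replicate (c + 1) True @ replicate (a + 1) False) m" .
  qed (use y nested_nonneg[OF q, of 0] in \<open>auto intro!: mult_nonneg_nonneg sum_nonneg simp del: nested.simps index_word_simps\<close>)
  have adm: "admissible (?h e)" for e
    by (auto simp: admissible_def)
  have "word_val q y (replicate (c + 1) True @ replicate (a + 1) False) =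
      (\<Sum>j. \<Sum>m. ennreal (y ^ j * (\<Sum>e\<in>?P j. nested q 0 (index_word (?h e)) m)))"
    unfolding word_val_def 1 by (rule ennreal_suminf_swap)
  also have "\<dots> = (\<Sum>j. ennreal (y ^ j) * (\<Sum>e\<in>?P j. word_val q 0 (index_word (?h e))))"
  proof (intro suminf_cong)
    fix j
    have "ennreal (y ^ j * (\<Sum>e\<in>?P j. nested q 0 (index_word (?h e)) m)) =
          ennreal (y ^ j) * (\<Sum>e\<in>?P j. ennreal (nested q 0 (index_word (?h e)) m))" for m
      using y nested_nonneg[OF q, of 0] by (subst sum_ennreal) (auto simp: ennreal_mult sum_nonneg simp del: nested.simps index_word_simps)
    thus "(\<Sum>m. ennreal (y ^ j * (\<Sum>e\<in>?P j. nested q 0 (index_word (?h e)) m))) =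
        ennreal (y ^ j) * (\<Sum>e\<in>?P j. word_val q 0 (index_word (?h e)))"
      by (simp add: word_val_def suminf_sum del: sum_ennreal nested.simps index_word_simps)
  qed
  also have "\<dots> = (\<Sum>j. ennreal (y ^ j * (\<Sum>e\<in>?P j. qmzv q (?h e))))"
    using y qmzv_nonneg[OF q] by (simp only: word_val_index_word[OF q adm])
      (simp add: ennreal_mult sum_nonneg)
  also have "\<dots> = (\<Sum>j. ennreal (y ^ j * (\<Sum>\<beta>\<in>I0 (a + 1) (a + 1 + (j + 1)). qmzv q ((hd \<beta> + c) # tl \<beta>))))"
  proof (intro suminf_cong)
    fix j
    have "(\<Sum>e\<in>?P j. qmzv q (?h e)) = (\<Sum>\<beta>\<in>I0 (a + 1) (a + 1 + (j + 1)). qmzv q ((hd \<beta> + c) # tl \<beta>))"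
      using sum.reindex_bij_betw[OF bij_betw_weak_compositions_I0, of "\<lambda>\<beta>. qmzv q ((hd \<beta> + c) # tl \<beta>)" a j]
      by simp
    thus "ennreal (y ^ j * (\<Sum>e\<in>?P j. qmzv q (?h e))) =
        ennreal (y ^ j * (\<Sum>\<beta>\<in>I0 (a + 1) (a + 1 + (j + 1)). qmzv q ((hd \<beta> + c) # tl \<beta>)))"
      by (simp only:)
  qed
  finally show ?thesis .
qed

end

section \<open>The two reductions and the theorem\<close>

text \<open>Both sides are coefficients of \<open>y\<^sup>j\<close> in values of words that are dual to each other. These values
  are finite: for \<open>y = 0\<close> they equal \<open>\<zeta>\<^sub>q(c + 2, 1\<^sup>a)\<close>, and the deformation preserves finiteness.\<close>

lemma hook_sum_symmetric:
  assumes q: "0 < q" "q < 1"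
  shows "(\<Sum>\<beta>\<in>I0 (a + 1) (a + 1 + (j + 1)). qmzv q ((hd \<beta> + c) # tl \<beta>)) =
         (\<Sum>\<beta>\<in>I0 (c + 1) (c + 1 + (j + 1)). qmzv q ((hd \<beta> + a) # tl \<beta>))"
proof (rule ennreal_powser_eqD[of
      "\<lambda>j. \<Sum>\<beta>\<in>I0 (a + 1) (a + 1 + (j + 1)). qmzv q ((hd \<beta> + c) # tl \<beta>)"
      "\<lambda>j. \<Sum>\<beta>\<in>I0 (c + 1) (c + 1 + (j + 1)). qmzv q ((hd \<beta> + a) # tl \<beta>)"])
  fix y :: real assume "0 < y" "y < 1"
  hence y: "0 \<le> y" "y < 1" by auto
  let ?w = "\<lambda>c a. replicate (c + 1) True @ replicate (a + 1) False"
  have "word_val q y (?w c a) = word_val q y (dual (?w c a))"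
    by (rule word_val_dual[OF q y, symmetric]) auto
  also have "dual (?w c a) = ?w a c"
    by (simp only: dual_append dual_replicate simp_thms)
  finally show "(\<Sum>j. ennreal (y ^ j * (\<Sum>\<beta>\<in>I0 (a + 1) (a + 1 + (j + 1)). qmzv q ((hd \<beta> + c) # tl \<beta>)))) =
         (\<Sum>j. ennreal (y ^ j * (\<Sum>\<beta>\<in>I0 (c + 1) (c + 1 + (j + 1)). qmzv q ((hd \<beta> + a) # tl \<beta>))))"
    unfolding word_val_hook_series[OF q y] .
  have "?w c a = index_word ((c + 2) # replicate a 1)"
    by (simp only: index_word_simps) simp
  moreover have "admissible ((c + 2) # replicate a 1)"
    by (auto simp: admissible_def)
  ultimately have "word_val q 0 (?w c a) \<noteq> top"
    using word_val_index_word[OF q] by (metis ennreal_neq_top)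
  thus "(\<Sum>j. ennreal (y ^ j * (\<Sum>\<beta>\<in>I0 (a + 1) (a + 1 + (j + 1)). qmzv q ((hd \<beta> + c) # tl \<beta>)))) \<noteq> top"
    using word_val_finite[OF q y] by (metis word_val_hook_series[OF q y])
qed (use qmzv_nonneg[OF q] in \<open>auto intro!: sum_nonneg\<close>)

text \<open>The letters \<open>False\<close> at the end of a word, which stand for appended entries \<open>1\<close>, become letters
  \<open>True\<close> at the beginning of its dual, and there they enlarge the first entry.\<close>

lemma sum_qmzv_append_ones:
  assumes q: "0 < q" "q < 1"
  shows "(\<Sum>\<alpha>\<in>I0 r (r + s). qmzv q (\<alpha> @ replicate a 1)) =
         (\<Sum>\<beta>\<in>I0 s (s + r). qmzv q ((hd \<beta> + a) # tl \<beta>))"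
proof -
  have "ennreal (\<Sum>\<alpha>\<in>I0 r (r + s). qmzv q (\<alpha> @ replicate a 1)) =
        (\<Sum>\<alpha>\<in>I0 r (r + s). word_val q 0 (index_word \<alpha> @ replicate a False))"
  proof -
    have "ennreal (qmzv q (\<alpha> @ replicate a 1)) = word_val q 0 (index_word \<alpha> @ replicate a False)"
      if "\<alpha> \<in> I0 r (r + s)" for \<alpha>
    proof -
      have "admissible (\<alpha> @ replicate a 1)"
        using that by (auto simp: I0_def admissible_def)
      thus ?thesis by (simp only: index_word_simps flip: word_val_index_word[OF q])
    qed
    thus ?thesis using qmzv_nonneg[OF q] by (simp flip: sum_ennreal)
  qed
  also have "\<dots> = (\<Sum>w\<in>admissible_words r s. word_val q 0 (w @ replicate a False))"
    by (rule sum.reindex_bij_betw[OF bij_betw_index_word])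
  also have "\<dots> = (\<Sum>w\<in>admissible_words r s. word_val q 0 (replicate a True @ dual w))"
  proof (rule sum.cong)
    fix w assume "w \<in> admissible_words r s"
    hence "word_val q 0 (dual (w @ replicate a False)) = word_val q 0 (w @ replicate a False)"
      by (intro word_val_dual[OF q]) (auto simp: admissible_words_def last_append)
    thus "word_val q 0 (w @ replicate a False) = word_val q 0 (replicate a True @ dual w)"
      by (simp add: dual_append dual_replicate)
  qed simp
  also have "\<dots> = (\<Sum>w\<in>admissible_words s r. word_val q 0 (replicate a True @ w))"
    by (rule sum.reindex_bij_betw[OF bij_betw_dual])
  also have "\<dots> = (\<Sum>\<beta>\<in>I0 s (s + r). word_val q 0 (replicate a True @ index_word \<beta>))"
    by (rule sum.reindex_bij_betw[OF bij_betw_index_word, symmetric])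
  also have "\<dots> = (\<Sum>\<beta>\<in>I0 s (s + r). ennreal (qmzv q ((hd \<beta> + a) # tl \<beta>)))"
  proof (rule sum.cong)
    fix \<beta> assume "\<beta> \<in> I0 s (s + r)"
    then obtain k \<beta>' where \<beta>: "\<beta> = k # \<beta>'" "k \<ge> 2" "\<forall>k\<in>set \<beta>'. k \<ge> 1"
      by (cases \<beta>) (auto simp: I0_def admissible_def)
    have "replicate a True @ index_word \<beta> = index_word ((k + a) # \<beta>')"
      using \<beta> by (simp add: add.commute[of k] flip: append_assoc replicate_add)
    moreover have "admissible ((k + a) # \<beta>')"
      using \<beta> by (auto simp: admissible_def)
    ultimately show "word_val q 0 (replicate a True @ index_word \<beta>) = ennreal (qmzv q ((hd \<beta> + a) # tl \<beta>))"
      using word_val_index_word[OF q] \<beta>(1) by (metis list.sel(1,3))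
  qed simp
  finally show ?thesis
    using qmzv_nonneg[OF q] by (simp add: sum_nonneg)
qed

text \<open>After \<open>sum_qmzv_append_ones\<close> the sum has depth \<open>c + 1\<close> and first entry shifted by \<open>a\<close>, where
  \<open>c = n - b - 1\<close>; the symmetry lemma exchanges the two.\<close>

theorem theorem1p1:
  fixes q :: real and a b n :: nat
  assumes "0 < q" and "q < 1" and "b \<ge> 1" and "n \<ge> b + 1"
  shows "(\<Sum>\<alpha>\<in>I0 b n. qmzv q (\<alpha> @ replicate a 1)) =
         (\<Sum>\<beta>\<in>I0 (a + 1) (a + b + 1). qmzv q ((hd \<beta> + n - b - 1) # tl \<beta>))"
proof -
  define c j where "c = n - b - 1" and "j = b - 1"
  have n: "n = b + (c + 1)" and b: "b = j + 1"
    using assms by (auto simp: c_def j_def)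
  have "(\<Sum>\<alpha>\<in>I0 b n. qmzv q (\<alpha> @ replicate a 1)) =
        (\<Sum>\<beta>\<in>I0 (c + 1) (c + 1 + (j + 1)). qmzv q ((hd \<beta> + a) # tl \<beta>))"
    unfolding n b by (rule sum_qmzv_append_ones[OF assms(1,2)])
  also have "\<dots> = (\<Sum>\<beta>\<in>I0 (a + 1) (a + 1 + (j + 1)). qmzv q ((hd \<beta> + c) # tl \<beta>))"
    by (rule hook_sum_symmetric[OF assms(1,2)])
  also have "\<dots> = (\<Sum>\<beta>\<in>I0 (a + 1) (a + b + 1). qmzv q ((hd \<beta> + n - b - 1) # tl \<beta>))"
    by (simp add: n b)
  finally show ?thesis .
qed

end
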